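(* Let $(A,N)$ be a fuzzy Banach algebra and let $(B,N')$ be a fuzzy normed space. Let $\varphi: A\times A\to B$ be a function such that for some real $\alpha$ with $0<\alpha<2$, $$N'(\varphi(2a,2b),t)\ \geq\ N'(\alpha\varphi(a,b),t)$$ for all $a,b\in A$ and all $t>0$. Suppose that $f:A\to A$ is a function such that $$N(f(a+b)-f(a)-f(b),t)\ \geq\ N'(\varphi(a,b),t)$$ and $$N(f(ab)-af(b)-f(a)b,s)\ \geq\ N'(\varphi(a,b),s)$$ for all $a,b\in A$ and all $t,s>0$. Then there exists a unique ring derivation $d:A\to A$ such that $$N(f(a)-d(a),t)\ \geq\ N'\!\left(\frac{2\varphi(a,a)}{2-\alpha},t\right)$$ for all $a\in A$ and all $t>0$.
   Context: Fuzzy norm: let $X$ be a real linear space. A function $N:X\times\mathbb{R}\to[0,1]$ is a fuzzy norm on $X$ if for all $x,y\in X$ and all $a,b\in\mathbb{R}$: (N1) $N(x,a)=0$ for $a\le 0$; (N2) $x=0$ if and only if $N(x,a)=1$ for all $a>0$; (N3) $N(ax,b)=N(x,b/|a|)$ if $a\ne 0$; (N4) $N(x+y,a+b)\ge\min\{N(x,a),N(y,b)\}$; (N5) $N(x,\cdot)$ is non-decreasing on $\mathbb{R}$ and $\lim_{a\to\infty}N(x,a)=1$; (N6) for $x\neq 0$, $N(x,\cdot)$ is (upper semi) continuous on $\mathbb{R}$. The pair $(X,N)$ is then called a fuzzy normed (linear) space. Convergence and completeness: a sequence $\{x_n\}$ in $X$ converges to $x\in X$ if $\lim_{n\to\infty}N(x_n-x,a)=1$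 for all $a>0$. It is Cauchy if for each $\epsilon>0$ and each $a>0$ there exists $n_0$ such that $N(x_{n+p}-x_n,a)>1-\epsilon$ for all $n\ge n_0$ and all $p>0$. The fuzzy normed space is complete if every Cauchy sequence converges. Fuzzy Banach algebra: a pair $(X,N)$ where $X$ is a (real) algebra, $(X,N)$ is a complete fuzzy normed space, and $N(xy,ab)\ge\min\{N(x,a),N(y,b)\}$ for all $x,y\in X$ and all $a,b\in\mathbb{R}$. Ring derivation: for an algebra $A$, a function $d:A\to A$ is a ring derivation if $d(a+b)=d(a)+d(b)$ and $d(ab)=a\,d(b)+d(a)\,b$ for all $a,b\in A$ (homogeneity with respect to scalars is not required). *)

theory Defs
  imports "HOL-Analysis.Analysis"
begin

definition upper_semicontinuous :: "(real \<Rightarrow> real) \<Rightarrow> bool" where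
  "upper_semicontinuous g \<longleftrightarrow> (\<forall>a c. g a < c \<longrightarrow> eventually (\<lambda>b. g b < c) (nhds a))"

(* N6 asks only for upper semicontinuity, the weaker of the two usual variants of this axiom
   (the other one being continuity); every space satisfying the stronger variant is covered. *)
locale fuzzy_normed_space =
  fixes N :: "'a::real_vector \<Rightarrow> real \<Rightarrow> real"
  assumes range: "N x a \<in> {0..1}"
    and N1: "a \<le> 0 \<Longrightarrow> N x a = 0"
    and N2: "x = 0 \<longleftrightarrow> (\<forall>a>0. N x a = 1)"
    and N3: "a \<noteq> 0 \<Longrightarrow> N (a *\<^sub>R x) b = N x (b / \<bar>a\<bar>)"
    and N4: "N (x + y) (a + b) \<ge> min (N x a) (N y b)"
    and N5_mono: "mono (N x)"
    and N5_lim: "(N x \<longlongrightarrow> 1) at_top"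
    and N6: "x \<noteq> 0 \<Longrightarrow> upper_semicontinuous (N x)"

definition fuzzy_converges ::
    "('a::real_vector \<Rightarrow> real \<Rightarrow> real) \<Rightarrow> (nat \<Rightarrow> 'a) \<Rightarrow> 'a \<Rightarrow> bool" where
  "fuzzy_converges N X x \<longleftrightarrow> (\<forall>a>0. (\<lambda>n. N (X n - x) a) \<longlonglongrightarrow> 1)"

definition fuzzy_Cauchy ::
    "('a::real_vector \<Rightarrow> real \<Rightarrow> real) \<Rightarrow> (nat \<Rightarrow> 'a) \<Rightarrow> bool" where
  "fuzzy_Cauchy N X \<longleftrightarrow>
     (\<forall>\<epsilon>>0. \<forall>a>0. \<exists>n0. \<forall>n\<ge>n0. \<forall>p>0. N (X (n + p) - X n) a > 1 - \<epsilon>)"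

(* The class real_algebra consists of associative real algebras, not assumed to be unital
   or commutative. *)
locale fuzzy_banach_algebra = fuzzy_normed_space N
  for N :: "'a::real_algebra \<Rightarrow> real \<Rightarrow> real" +
  assumes complete: "fuzzy_Cauchy N X \<Longrightarrow> \<exists>x. fuzzy_converges N X x"
    and mult: "N (x * y) (a * b) \<ge> min (N x a) (N y b)"

definition ring_derivation :: "('a::real_algebra \<Rightarrow> 'a) \<Rightarrow> bool" where
  "ring_derivation d \<longleftrightarrow>
     (\<forall>a b. d (a + b) = d a + d b) \<and> (\<forall>a b. d (a * b) = a * d b + d a * b)"

end

theory Submission
  imports Defs
begin

text \<open>
  In \<open>N(x, t) = l\<close>, call \<open>t\<close> the cost and \<open>l\<close> the level: \<open>x\<close> has size at most \<open>t\<close> with degree of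
  truth \<open>l\<close>. The derivation is found by the direct method of Hyers. Put
  \<open>F\<^sub>n(a) = f(2\<^sup>n a) / 2\<^sup>n\<close>. Taking \<open>b = a\<close> in the additive estimate shows that passing from
  \<open>F\<^sub>n(a)\<close> to \<open>F\<^bsub>n+1\<^esub>(a)\<close> costs at most \<open>(1/2) (\<alpha>/2)\<^sup>n s\<close> at the level
  \<open>N'(\<phi>(a,a), s)\<close>. As \<open>\<alpha>/2 < 1\<close>, these costs form a convergent geometric series, so that
  \<open>F\<^sub>n(a)\<close> is Cauchy and its limit \<open>d(a)\<close> is reached from
  \<open>F\<^sub>0(a) = f(a)\<close>, at the same level, for every cost larger than \<open>(1/2) / (1 - \<alpha>/2) s = s / (2 - \<alpha>)\<close>
  (\<open>geometric_increments_Cauchy\<close>, \<open>geometric_increments_limit\<close>). The factor 2 in the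
  asserted bound \<open>2 \<phi>(a,a) / (2 - \<alpha>)\<close> leaves room for the passage to the limit.

  The two defects of \<open>f\<close> at \<open>(2\<^sup>n a, 2\<^sup>n b)\<close> are controlled by \<open>N'(\<phi>(a,b), t / \<alpha>\<^sup>n)\<close>
  (\<open>control_iterate\<close>). Dividing the additive defect by \<open>2\<^sup>n\<close> and the multiplicative one by \<open>4\<^sup>n\<close>
  replaces \<open>t\<close> by \<open>2\<^sup>n t\<close> and \<open>4\<^sup>n t\<close>; both bounds then tend to 1 because \<open>\<alpha> < 2\<close>
  (\<open>control_vanishes\<close>), and so the defects vanish in the limit. For the product rule the term
  \<open>f(2\<^sup>n a \<cdot> 2\<^sup>n b) / 4\<^sup>n\<close> is \<open>F\<^bsub>2n\<^esub>(ab)\<close>, a subsequence of a sequence converging to \<open>d(ab)\<close>.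

  For uniqueness, let \<open>d1\<close> be any additive map satisfying the asserted bound. Then
  \<open>F\<^sub>n(a) - d1(a)\<close> is \<open>2\<^bsup>-n\<^esup>\<close> times the value of \<open>f - d1\<close> at \<open>2\<^sup>n a\<close>, and the same comparison of
  \<open>\<alpha>\<^sup>n\<close> with \<open>2\<^sup>n\<close> makes it negligible. So \<open>d1(a)\<close> is the limit of \<open>F\<^sub>n(a)\<close> too.
\<close>

section \<open>Limits in fuzzy normed spaces\<close>

context fuzzy_normed_space
begin

lemma le_one: "N x a \<le> 1"
  using range[of x a] by simp

lemma N_mono: "a \<le> b \<Longrightarrow> N x a \<le> N x b"
  using N5_mono by (rule monoD)

lemma N_minus: "N (- x) a = N x a"
  using N3[of "-1" x a] by simp

lemma N_diff_commute: "N (x - y) a = N (y - x) a"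
  using N_minus[of "x - y"] by simp

lemma N_scale: "c > 0 \<Longrightarrow> N (c *\<^sub>R x) a = N x (a / c)"
  using N3[of c x a] by simp

lemma N_scale_inverse: "c > 0 \<Longrightarrow> N (x /\<^sub>R c) a = N x (c * a)"
  using N_scale[of "inverse c" x a] by (simp add: field_simps)

lemma N_add_half: "min (N x (a / 2)) (N y (a / 2)) \<le> N (x + y) a"
  using N4[of x "a / 2" y "a / 2"] by simp

lemma tendsto_one_if_ge:
  assumes "\<And>n. g n \<le> N (Y n) a" "g \<longlonglongrightarrow> 1"
  shows "(\<lambda>n. N (Y n) a) \<longlonglongrightarrow> 1"
  using assms by (intro tendsto_sandwich[of g "\<lambda>n. N (Y n) a" sequentially "\<lambda>_. 1" 1])
    (auto simp: le_one)

lemma tendsto_one_min: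
  assumes "g \<longlonglongrightarrow> 1" "h \<longlonglongrightarrow> (1::real)" "\<And>n. min (g n) (h n) \<le> N (Y n) a"
  shows "(\<lambda>n. N (Y n) a) \<longlonglongrightarrow> 1"
  using tendsto_one_if_ge[of "\<lambda>n. min (g n) (h n)" Y a] tendsto_min[OF assms(1,2)] assms(3)
  by simp

lemma converges_add:
  assumes "fuzzy_converges N X x" "fuzzy_converges N Y y"
  shows "fuzzy_converges N (\<lambda>n. X n + Y n) (x + y)"
  unfolding fuzzy_converges_def
proof (intro allI impI)
  fix a :: real
  assume "a > 0"
  then have "(\<lambda>n. N (X n - x) (a / 2)) \<longlonglongrightarrow> 1" "(\<lambda>n. N (Y n - y) (a / 2)) \<longlonglongrightarrow> 1"
    using assms by (auto simp: fuzzy_converges_def)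
  then show "(\<lambda>n. N (X n + Y n - (x + y)) a) \<longlonglongrightarrow> 1"
    by (rule tendsto_one_min) (use N_add_half in \<open>simp add: add_diff_add\<close>)
qed

lemma converges_if_diff_null:
  assumes "fuzzy_converges N X x" "fuzzy_converges N (\<lambda>n. Y n - X n) 0"
  shows "fuzzy_converges N Y x"
  using converges_add[OF assms(2,1)] by simp

lemma converges_unique:
  assumes "fuzzy_converges N X x" "fuzzy_converges N X y"
  shows "x = y"
proof -
  have "N (x - y) a = 1" if "a > 0" for a
  proof -
    have "(\<lambda>n. N (X n - x) (a / 2)) \<longlonglongrightarrow> 1" "(\<lambda>n. N (X n - y) (a / 2)) \<longlonglongrightarrow> 1"
      using assms that by (auto simp: fuzzy_converges_def)
    then have "(\<lambda>n. N (x - y) a) \<longlonglongrightarrow> 1"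
    proof (rule tendsto_one_min)
      fix n
      show "min (N (X n - x) (a / 2)) (N (X n - y) (a / 2)) \<le> N (x - y) a"
        using N_add_half[of "x - X n" a "X n - y"] by (simp add: N_diff_commute[of x])
    qed
    then show ?thesis
      by (simp add: LIMSEQ_const_iff)
  qed
  then show ?thesis
    using N2[of "x - y"] by simp
qed

lemma converges_subseq:
  assumes "fuzzy_converges N X x" "strict_mono r"
  shows "fuzzy_converges N (\<lambda>n. X (r n)) x"
  using assms LIMSEQ_subseq_LIMSEQ unfolding fuzzy_converges_def o_def by blast

lemma N_at_growing_arg: "filterlim s at_top sequentially \<Longrightarrow> (\<lambda>n. N x (s n)) \<longlonglongrightarrow> 1"
  using filterlim_compose[OF N5_lim] .

section \<open>Sequences with geometrically decreasing increments\<close>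

text \<open>
  Costs add along a telescoping sum, while the level stays the minimum of the levels. The sum is
  taken over \<open>Suc p\<close> increments because an empty sum has cost 0, where the level is 0.
\<close>

lemma telescope_bound:
  assumes "\<And>i. m \<le> N (X (Suc i) - X i) (t i)"
  shows "m \<le> N (X (n + Suc p) - X n) (\<Sum>i<Suc p. t (n + i))"
proof (induction p)
  case 0
  show ?case using assms[of n] by simp
next
  case (Suc p)
  have "m \<le> min (N (X (n + Suc p) - X n) (\<Sum>i<Suc p. t (n + i)))
                (N (X (Suc (n + Suc p)) - X (n + Suc p)) (t (n + Suc p)))"
    using Suc assms by simp
  also have "\<dots> \<le> N (X (n + Suc p) - X n + (X (Suc (n + Suc p)) - X (n + Suc p)))
                    ((\<Sum>i<Suc p. t (n + i)) + t (n + Suc p))"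
    by (rule N4)
  also have "\<dots> = N (X (n + Suc (Suc p)) - X n) (\<Sum>i<Suc (Suc p). t (n + i))"
    by simp
  finally show ?case .
qed

lemma geometric_increments_bound:
  assumes incr: "\<And>i. m \<le> N (X (Suc i) - X i) (c * q ^ i)"
    and "0 < q" "q < 1" "0 \<le> c" "0 < p"
  shows "m \<le> N (X (n + p) - X n) (c * q ^ n / (1 - q))"
proof -
  obtain k where p: "p = Suc k"
    using \<open>0 < p\<close> gr0_conv_Suc by auto
  have "(\<Sum>i<Suc k. c * q ^ (n + i)) = c * q ^ n * (\<Sum>i<Suc k. q ^ i)"
    by (simp only: power_add sum_distrib_left mult.assoc)
  also have "(\<Sum>i<Suc k. q ^ i) = (1 - q ^ Suc k) / (1 - q)"
    using assms by (intro sum_gp_strict[THEN trans]) auto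
  also have "c * q ^ n * \<dots> \<le> c * q ^ n * (1 / (1 - q))"
    using assms by (intro mult_left_mono divide_right_mono) auto
  finally have "(\<Sum>i<Suc k. c * q ^ (n + i)) \<le> c * q ^ n / (1 - q)"
    by simp
  then show ?thesis
    using telescope_bound[where t = "\<lambda>i. c * q ^ i", OF incr, of n k] N_mono unfolding p
    by (meson order_trans)
qed

text \<open>
  The levels are given by a function \<open>g\<close> with limit 1, so a level close to 1 can be reached by
  fixing a large \<open>s\<close>; the tails \<open>c q\<^sup>n s / (1 - q)\<close> of the geometric series are then eventually
  below any prescribed cost.
\<close>

lemma geometric_increments_Cauchy:
  assumes incr: "\<And>i s. s > 0 \<Longrightarrow> g s \<le> N (X (Suc i) - X i) (c * s * q ^ i)"
    and g: "(g \<longlongrightarrow> 1) at_top"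
    and q: "0 < q" "q < 1" and c: "0 \<le> c"
  shows "fuzzy_Cauchy N X"
  unfolding fuzzy_Cauchy_def
proof (intro allI impI)
  fix \<epsilon> a :: real
  assume "\<epsilon> > 0" "a > 0"
  have "eventually (\<lambda>s. g s > 1 - \<epsilon> \<and> s > 0) at_top"
    using order_tendstoD(1)[OF g, of "1 - \<epsilon>"] \<open>\<epsilon> > 0\<close> eventually_gt_at_top[of "0::real"]
    by (simp add: eventually_conj)
  then obtain s where s: "g s > 1 - \<epsilon>" "s > 0"
    using eventually_happens trivial_limit_at_top_linorder by blast
  have "(\<lambda>n. c * s * q ^ n / (1 - q)) \<longlonglongrightarrow> c * s * 0 / (1 - q)"
    using q by (intro tendsto_intros LIMSEQ_power_zero) auto
  then have "eventually (\<lambda>n. c * s * q ^ n / (1 - q) < a) sequentially"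
    using \<open>a > 0\<close> by (intro order_tendstoD) auto
  then obtain n0 where n0: "\<And>n. n \<ge> n0 \<Longrightarrow> c * s * q ^ n / (1 - q) < a"
    unfolding eventually_sequentially by blast
  show "\<exists>n0. \<forall>n\<ge>n0. \<forall>p>0. 1 - \<epsilon> < N (X (n + p) - X n) a"
  proof (intro exI allI impI)
    fix n p :: nat
    assume "n0 \<le> n" "0 < p"
    have "g s \<le> N (X (n + p) - X n) (c * s * q ^ n / (1 - q))"
      using incr s q c \<open>0 < p\<close> by (intro geometric_increments_bound) auto
    also have "\<dots> \<le> N (X (n + p) - X n) a"
      using n0[OF \<open>n0 \<le> n\<close>] by (intro N_mono) simp
    finally show "1 - \<epsilon> < N (X (n + p) - X n) a"
      using s by simp
  qed
qed

text \<open>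
  The distance from the first term to the limit is split at a late term: the partial sums of the
  geometric series stay below \<open>c / (1 - q)\<close>, and the remaining distance fits into any \<open>\<delta> > 0\<close> at a
  level tending to 1.
\<close>

lemma geometric_increments_limit:
  assumes incr: "\<And>i. m \<le> N (X (Suc i) - X i) (c * q ^ i)"
    and q: "0 < q" "q < 1" and c: "0 \<le> c" and \<delta>: "\<delta> > 0"
    and lim: "fuzzy_converges N X x"
  shows "min m 1 \<le> N (X 0 - x) (c / (1 - q) + \<delta>)"
proof (rule LIMSEQ_le_const2)
  show "(\<lambda>n. min m (N (X (Suc n) - x) \<delta>)) \<longlonglongrightarrow> min m 1"
    using converges_subseq[OF lim, of Suc] \<delta>
    by (intro tendsto_intros) (auto simp: fuzzy_converges_def strict_mono_def)
  show "\<exists>n0. \<forall>n\<ge>n0. min m (N (X (Suc n) - x) \<delta>) \<le> N (X 0 - x) (c / (1 - q) + \<delta>)"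
  proof (intro exI allI impI)
    fix n
    have "m \<le> N (X 0 - X (Suc n)) (c / (1 - q))"
      using geometric_increments_bound[OF incr q c, of "Suc n" 0]
      by (simp add: N_diff_commute[of "X 0"])
    then show "min m (N (X (Suc n) - x) \<delta>) \<le> N (X 0 - x) (c / (1 - q) + \<delta>)"
      using N4[of "X 0 - X (Suc n)" "c / (1 - q)" "X (Suc n) - x" \<delta>] by simp
  qed
qed

end

section \<open>Continuity of multiplication\<close>

context fuzzy_banach_algebra
begin

text \<open>
  The level of a product at cost \<open>t\<close> is estimated by splitting \<open>t = s (t / s)\<close>, with \<open>s\<close> so large
  that the fixed factor \<open>x\<close> has level near 1 at \<open>s\<close>. The products are abstracted to \<open>Z\<close>, which
  covers multiplication by \<open>x\<close> from either side.
\<close>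

lemma null_product:
  assumes "fuzzy_converges N Y 0"
    and prod: "\<And>n s t. min (N x s) (N (Y n) t) \<le> N (Z n) (s * t)"
  shows "fuzzy_converges N Z 0"
  unfolding fuzzy_converges_def
proof (intro allI impI)
  fix t :: real
  assume "t > 0"
  show "(\<lambda>n. N (Z n - 0) t) \<longlonglongrightarrow> 1"
  proof (rule order_tendstoI)
    fix l :: real
    assume "l < 1"
    then have "eventually (\<lambda>s. N x s > l \<and> s > 0) at_top"
      using order_tendstoD(1)[OF N5_lim, of l x] eventually_gt_at_top[of "0::real"]
      by (simp add: eventually_conj)
    then obtain s where s: "N x s > l" "s > 0"
      using eventually_happens trivial_limit_at_top_linorder by blast
    then have "(\<lambda>n. N (Y n) (t / s)) \<longlonglongrightarrow> 1"
      using assms(1) \<open>t > 0\<close> by (simp add: fuzzy_converges_def)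
    then have "eventually (\<lambda>n. l < N (Y n) (t / s)) sequentially"
      using \<open>l < 1\<close> by (rule order_tendstoD)
    then show "eventually (\<lambda>n. l < N (Z n - 0) t) sequentially"
    proof (rule eventually_mono)
      fix n
      assume "l < N (Y n) (t / s)"
      then show "l < N (Z n - 0) t"
        using prod[of s n "t / s"] s by simp
    qed
  next
    fix u :: real
    assume "1 < u"
    then show "eventually (\<lambda>n. N (Z n - 0) t < u) sequentially"
      by (intro always_eventually) (use le_one order_le_less_trans in blast)
  qed
qed

lemma converges_mult_left:
  assumes "fuzzy_converges N Y y"
  shows "fuzzy_converges N (\<lambda>n. x * Y n) (x * y)"
proof -
  have "fuzzy_converges N (\<lambda>n. x * (Y n - y)) 0"
    by (rule null_product[of "\<lambda>n. Y n - y" x])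
      (use assms in \<open>simp_all add: fuzzy_converges_def mult\<close>)
  then show ?thesis
    by (simp add: fuzzy_converges_def algebra_simps)
qed

lemma converges_mult_right:
  assumes "fuzzy_converges N Y y"
  shows "fuzzy_converges N (\<lambda>n. Y n * x) (y * x)"
proof -
  have prod: "min (N x s) (N z t) \<le> N (z * x) (s * t)" for z s t
    using mult[of z t x s] by (simp add: mult.commute[of t s] min.commute)
  have "fuzzy_converges N (\<lambda>n. (Y n - y) * x) 0"
    by (rule null_product[of "\<lambda>n. Y n - y" x, OF _ prod])
      (use assms in \<open>simp add: fuzzy_converges_def\<close>)
  then show ?thesis
    by (simp add: fuzzy_converges_def algebra_simps)
qed

end

section \<open>Control functions under doubling of the arguments\<close>

text \<open>
  Each doubling multiplies the control value by at most \<open>\<alpha>\<close> in the fuzzy order, and by homogeneity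
  a scalar factor on the vector is a division of the cost.
\<close>

lemma control_iterate:
  fixes N' :: "'b::real_vector \<Rightarrow> real \<Rightarrow> real" and \<phi> :: "'a::real_vector \<Rightarrow> 'a \<Rightarrow> 'b"
  assumes "fuzzy_normed_space N'" and "0 < \<alpha>"
    and dbl: "\<And>a b t. t > 0 \<Longrightarrow> N' (\<phi> (2 *\<^sub>R a) (2 *\<^sub>R b)) t \<ge> N' (\<alpha> *\<^sub>R \<phi> a b) t"
    and "t > 0"
  shows "N' (\<phi> a b) (t / \<alpha> ^ n) \<le> N' (\<phi> (2 ^ n *\<^sub>R a) (2 ^ n *\<^sub>R b)) t"
  using \<open>t > 0\<close>
proof (induction n arbitrary: t)
  case 0
  then show ?case by simp
next
  case (Suc n)
  interpret N': fuzzy_normed_space N' by fact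
  have "N' (\<phi> a b) (t / \<alpha> ^ Suc n) = N' (\<phi> a b) ((t / \<alpha>) / \<alpha> ^ n)"
    by (simp add: field_simps)
  also have "\<dots> \<le> N' (\<phi> (2 ^ n *\<^sub>R a) (2 ^ n *\<^sub>R b)) (t / \<alpha>)"
    using Suc.prems \<open>0 < \<alpha>\<close> by (intro Suc.IH) simp
  also have "\<dots> = N' (\<alpha> *\<^sub>R \<phi> (2 ^ n *\<^sub>R a) (2 ^ n *\<^sub>R b)) t"
    using \<open>0 < \<alpha>\<close> by (simp add: N'.N_scale)
  also have "\<dots> \<le> N' (\<phi> (2 ^ Suc n *\<^sub>R a) (2 ^ Suc n *\<^sub>R b)) t"
    using dbl[OF Suc.prems, of "2 ^ n *\<^sub>R a" "2 ^ n *\<^sub>R b"] by simp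
  finally show ?case .
qed

text \<open>
  This turns the bounds on the defects of \<open>f\<close> into limits: \<open>\<beta> = 2\<close> serves the additive defect and
  \<open>\<beta> = 4\<close> the multiplicative one.
\<close>

lemma control_vanishes:
  fixes N' :: "'b::real_vector \<Rightarrow> real \<Rightarrow> real" and \<beta> :: real
  assumes "fuzzy_normed_space N'" and "0 < \<alpha>" and "\<alpha> < \<beta>" and "t > 0"
  shows "(\<lambda>n. N' y (\<beta> ^ n * t / \<alpha> ^ n)) \<longlonglongrightarrow> 1"
proof -
  interpret N': fuzzy_normed_space N' by fact
  have "filterlim (\<lambda>n. (\<beta> / \<alpha>) ^ n) at_top sequentially"
    using assms by (intro always_eventually
        filterlim_realpow_sequentially_gt1[THEN filterlim_at_infinity_imp_filterlim_at_top]) auto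
  then have "filterlim (\<lambda>n. t * (\<beta> / \<alpha>) ^ n) at_top sequentially"
    using \<open>t > 0\<close> by (intro filterlim_tendsto_pos_mult_at_top[OF tendsto_const]) auto
  then show ?thesis
    using N'.N_at_growing_arg by (simp add: power_divide mult.commute)
qed

section \<open>Stability of ring derivations\<close>

lemma additive_scale_power2:
  fixes d :: "'a::real_vector \<Rightarrow> 'a"
  assumes "\<And>a b. d (a + b) = d a + d b"
  shows "d (2 ^ n *\<^sub>R a) = 2 ^ n *\<^sub>R d a"
proof (induction n)
  case (Suc n)
  have "d (2 ^ Suc n *\<^sub>R a) = d (2 ^ n *\<^sub>R a + 2 ^ n *\<^sub>R a)"
    by (simp flip: scaleR_left_distrib)
  also have "\<dots> = 2 ^ n *\<^sub>R d a + 2 ^ n *\<^sub>R d a"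
    using Suc by (simp only: assms)
  also have "\<dots> = 2 ^ Suc n *\<^sub>R d a"
    by (simp flip: scaleR_left_distrib)
  finally show ?case .
qed simp

theorem theorem3p1:
  fixes N :: "'a::real_algebra \<Rightarrow> real \<Rightarrow> real"
    and N' :: "'b::real_vector \<Rightarrow> real \<Rightarrow> real"
    and \<phi> :: "'a \<Rightarrow> 'a \<Rightarrow> 'b"
    and f :: "'a \<Rightarrow> 'a"
    and \<alpha> :: real
  assumes "fuzzy_banach_algebra N"
    and "fuzzy_normed_space N'"
    and "0 < \<alpha>" and "\<alpha> < 2"
    and "\<And>a b t. t > 0 \<Longrightarrow> N' (\<phi> (2 *\<^sub>R a) (2 *\<^sub>R b)) t \<ge> N' (\<alpha> *\<^sub>R \<phi> a b) t"
    and "\<And>a b t. t > 0 \<Longrightarrow> N (f (a + b) - f a - f b) t \<ge> N' (\<phi> a b) t"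
    and "\<And>a b s. s > 0 \<Longrightarrow> N (f (a * b) - a * f b - f a * b) s \<ge> N' (\<phi> a b) s"
  shows "\<exists>!d. ring_derivation d \<and>
           (\<forall>a. \<forall>t>0. N (f a - d a) t \<ge> N' ((2 *\<^sub>R \<phi> a a) /\<^sub>R (2 - \<alpha>)) t)"
proof -
  interpret N: fuzzy_banach_algebra N by fact
  interpret N': fuzzy_normed_space N' by fact
  have iterate: "N' (\<phi> a b) (t / \<alpha> ^ n) \<le> N' (\<phi> (2 ^ n *\<^sub>R a) (2 ^ n *\<^sub>R b)) t"
    if "t > 0" for a b t n
    by (rule control_iterate) (use assms(2,3,5) that in auto)
  have bound_eq: "N' ((2 *\<^sub>R y) /\<^sub>R (2 - \<alpha>)) t = N' y ((2 - \<alpha>) * t / 2)" for y t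
    using \<open>\<alpha> < 2\<close> by (simp only: N'.N_scale_inverse N'.N_scale)
  define F where "F n a = f (2 ^ n *\<^sub>R a) /\<^sub>R 2 ^ n" for n a

  have incr: "N' (\<phi> a a) s \<le> N (F (Suc n) a - F n a) (1 / 2 * s * (\<alpha> / 2) ^ n)"
    if "s > 0" for a n s
  proof -
    have pos: "s * \<alpha> ^ n > 0"
      using that \<open>0 < \<alpha>\<close> by (intro mult_pos_pos zero_less_power)
    have "N' (\<phi> a a) s = N' (\<phi> a a) ((s * \<alpha> ^ n) / \<alpha> ^ n)"
      using \<open>0 < \<alpha>\<close> by simp
    also have "\<dots> \<le> N' (\<phi> (2 ^ n *\<^sub>R a) (2 ^ n *\<^sub>R a)) (s * \<alpha> ^ n)"
      using pos by (rule iterate)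
    also have "\<dots> \<le> N (f (2 ^ n *\<^sub>R a + 2 ^ n *\<^sub>R a) - f (2 ^ n *\<^sub>R a) - f (2 ^ n *\<^sub>R a)) (s * \<alpha> ^ n)"
      using pos by (rule assms(6))
    also have "2 ^ n *\<^sub>R a + 2 ^ n *\<^sub>R a = 2 ^ Suc n *\<^sub>R a"
      by (simp flip: scaleR_left_distrib)
    also have "N (f (2 ^ Suc n *\<^sub>R a) - f (2 ^ n *\<^sub>R a) - f (2 ^ n *\<^sub>R a)) (s * \<alpha> ^ n) =
        N ((f (2 ^ Suc n *\<^sub>R a) - f (2 ^ n *\<^sub>R a) - f (2 ^ n *\<^sub>R a)) /\<^sub>R 2 ^ Suc n)
          (1 / 2 * s * (\<alpha> / 2) ^ n)"
      by (subst N.N_scale_inverse) (simp_all add: power_divide)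
    also have "(f (2 ^ Suc n *\<^sub>R a) - f (2 ^ n *\<^sub>R a) - f (2 ^ n *\<^sub>R a)) /\<^sub>R 2 ^ Suc n
        = F (Suc n) a - F n a"
    proof -
      have "(z + z) /\<^sub>R 2 ^ Suc n = z /\<^sub>R 2 ^ n" for z :: 'a
        by (simp flip: scaleR_2)
      then show ?thesis
        by (simp only: F_def diff_diff_eq scaleR_diff_right)
    qed
    finally show ?thesis .
  qed

  have "\<exists>x. fuzzy_converges N (\<lambda>n. F n a) x" for a
    using \<open>0 < \<alpha>\<close> \<open>\<alpha> < 2\<close>
    by (intro N.complete N.geometric_increments_Cauchy[OF incr N'.N5_lim]) auto
  then obtain d where d: "fuzzy_converges N (\<lambda>n. F n a) (d a)" for a
    by metis

  have close: "N' ((2 *\<^sub>R \<phi> a a) /\<^sub>R (2 - \<alpha>)) t \<le> N (f a - d a) t" if "t > 0" for a t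
  proof -
    (* with this s the geometric series costs t / 2; the other half pays for the limit *)
    define s where "s = (2 - \<alpha>) * t / 2"
    have "s > 0"
      using that \<open>\<alpha> < 2\<close> by (simp add: s_def)
    have "min (N' (\<phi> a a) s) 1 \<le> N (F 0 a - d a) (1 / 2 * s / (1 - \<alpha> / 2) + t / 2)"
      using d[of a] incr[OF \<open>s > 0\<close>] that \<open>s > 0\<close> \<open>0 < \<alpha>\<close> \<open>\<alpha> < 2\<close>
      by (intro N.geometric_increments_limit) auto
    moreover have "1 / 2 * s / (1 - \<alpha> / 2) + t / 2 = t"
      using \<open>\<alpha> < 2\<close> by (simp add: s_def field_simps)
    ultimately show ?thesis
      unfolding bound_eq by (simp add: F_def N'.le_one flip: s_def)
  qed

  have add: "d (a + b) = d a + d b" for a b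
  proof (rule N.converges_unique[OF d])
    have "fuzzy_converges N (\<lambda>n. F n (a + b) - (F n a + F n b)) 0"
      unfolding fuzzy_converges_def
    proof (intro allI impI, rule N.tendsto_one_if_ge)
      fix t :: real and n :: nat
      assume "t > 0"
      then show "(\<lambda>n. N' (\<phi> a b) (2 ^ n * t / \<alpha> ^ n)) \<longlonglongrightarrow> 1"
        using assms by (intro control_vanishes)
      have "N' (\<phi> a b) (2 ^ n * t / \<alpha> ^ n) \<le> N' (\<phi> (2 ^ n *\<^sub>R a) (2 ^ n *\<^sub>R b)) (2 ^ n * t)"
        using \<open>t > 0\<close> by (intro iterate) simp
      also have "\<dots> \<le> N (f (2 ^ n *\<^sub>R a + 2 ^ n *\<^sub>R b) - f (2 ^ n *\<^sub>R a) - f (2 ^ n *\<^sub>R b)) (2 ^ n * t)"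
        using \<open>t > 0\<close> by (intro assms(6)) simp
      also have "\<dots> = N ((f (2 ^ n *\<^sub>R a + 2 ^ n *\<^sub>R b) - f (2 ^ n *\<^sub>R a) - f (2 ^ n *\<^sub>R b)) /\<^sub>R 2 ^ n) t"
        by (simp add: N.N_scale_inverse)
      also have "\<dots> = N (F n (a + b) - (F n a + F n b) - 0) t"
        by (simp add: F_def algebra_simps)
      finally show "N' (\<phi> a b) (2 ^ n * t / \<alpha> ^ n) \<le> N (F n (a + b) - (F n a + F n b) - 0) t" .
    qed
    then show "fuzzy_converges N (\<lambda>n. F n (a + b)) (d a + d b)"
      by (rule N.converges_if_diff_null[OF N.converges_add[OF d d]])
  qed

  have mult: "d (a * b) = a * d b + d a * b" for a b
  proof (rule N.converges_unique)
    show "fuzzy_converges N (\<lambda>n. F (2 * n) (a * b)) (d (a * b))"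
      by (rule N.converges_subseq[OF d]) (simp add: strict_mono_def)
    have "fuzzy_converges N (\<lambda>n. F (2 * n) (a * b) - (a * F n b + F n a * b)) 0"
      unfolding fuzzy_converges_def
    proof (intro allI impI, rule N.tendsto_one_if_ge)
      fix t :: real and n :: nat
      assume "t > 0"
      then show "(\<lambda>n. N' (\<phi> a b) (4 ^ n * t / \<alpha> ^ n)) \<longlonglongrightarrow> 1"
        using assms by (intro control_vanishes) auto
      let ?a = "2 ^ n *\<^sub>R a" and ?b = "2 ^ n *\<^sub>R b"
      have four: "(4::real) ^ n = 2 ^ n * 2 ^ n" "(2::real) ^ (2 * n) = 2 ^ n * 2 ^ n"
        by (simp_all add: power_mult_distrib[symmetric] power_mult power2_eq_square)
      have "N' (\<phi> a b) (4 ^ n * t / \<alpha> ^ n) \<le> N' (\<phi> ?a ?b) (4 ^ n * t)"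
        using \<open>t > 0\<close> by (intro iterate) simp
      also have "\<dots> \<le> N (f (?a * ?b) - ?a * f ?b - f ?a * ?b) (4 ^ n * t)"
        using \<open>t > 0\<close> by (intro assms(7)) simp
      also have "\<dots> = N ((f (?a * ?b) - ?a * f ?b - f ?a * ?b) /\<^sub>R 4 ^ n) t"
        by (simp add: N.N_scale_inverse)
      also have "(f (?a * ?b) - ?a * f ?b - f ?a * ?b) /\<^sub>R 4 ^ n
          = F (2 * n) (a * b) - (a * F n b + F n a * b) - 0"
      proof -
        have "inverse (2 ^ n) * inverse (2 ^ n) * 2 ^ n = inverse ((2::real) ^ n)"
          by simp
        then show ?thesis
          by (simp only: F_def four scaleR_diff_right scaleR_add_right diff_diff_eq diff_zero
              mult_scaleR_left mult_scaleR_right scaleR_scaleR inverse_mult_distrib)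
      qed
      finally show "N' (\<phi> a b) (4 ^ n * t / \<alpha> ^ n)
          \<le> N (F (2 * n) (a * b) - (a * F n b + F n a * b) - 0) t" .
    qed
    then show "fuzzy_converges N (\<lambda>n. F (2 * n) (a * b)) (a * d b + d a * b)"
      by (rule N.converges_if_diff_null[OF N.converges_add[OF
            N.converges_mult_left[OF d] N.converges_mult_right[OF d]]])
  qed

  have unique: "d1 = d"
    if "ring_derivation d1"
      and close1: "\<And>a t. t > 0 \<Longrightarrow> N' ((2 *\<^sub>R \<phi> a a) /\<^sub>R (2 - \<alpha>)) t \<le> N (f a - d1 a) t" for d1
  proof
    fix a
    have additive: "d1 (x + y) = d1 x + d1 y" for x y
      using \<open>ring_derivation d1\<close> by (simp add: ring_derivation_def)
    have "fuzzy_converges N (\<lambda>n. F n a) (d1 a)"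
      unfolding fuzzy_converges_def
    proof (intro allI impI, rule N.tendsto_one_if_ge)
      fix t :: real and n :: nat
      assume "t > 0"
      let ?a = "2 ^ n *\<^sub>R a"
      let ?t = "(2 - \<alpha>) * t / 2"
      have "?t > 0"
        using \<open>t > 0\<close> \<open>\<alpha> < 2\<close> by simp
      then show "(\<lambda>n. N' (\<phi> a a) (2 ^ n * ?t / \<alpha> ^ n)) \<longlonglongrightarrow> 1"
        using assms by (intro control_vanishes)
      have "N' (\<phi> a a) (2 ^ n * ?t / \<alpha> ^ n) \<le> N' (\<phi> ?a ?a) (2 ^ n * ?t)"
        using \<open>?t > 0\<close> by (intro iterate) simp
      also have "\<dots> = N' ((2 *\<^sub>R \<phi> ?a ?a) /\<^sub>R (2 - \<alpha>)) (2 ^ n * t)"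
        unfolding bound_eq by (simp add: mult_ac)
      also have "\<dots> \<le> N (f ?a - d1 ?a) (2 ^ n * t)"
        using \<open>t > 0\<close> by (intro close1) simp
      also have "\<dots> = N ((f ?a - d1 ?a) /\<^sub>R 2 ^ n) t"
        by (simp add: N.N_scale_inverse)
      also have "(f ?a - d1 ?a) /\<^sub>R 2 ^ n = F n a - d1 a"
        by (simp add: F_def additive_scale_power2[of d1, OF additive] scaleR_diff_right)
      finally show "N' (\<phi> a a) (2 ^ n * ?t / \<alpha> ^ n) \<le> N (F n a - d1 a) t" .
    qed
    then show "d1 a = d a"
      by (rule N.converges_unique) (rule d)
  qed

  show ?thesis
  proof (rule ex1I[of _ d])
    show "ring_derivation d \<and>
        (\<forall>a. \<forall>t>0. N (f a - d a) t \<ge> N' ((2 *\<^sub>R \<phi> a a) /\<^sub>R (2 - \<alpha>)) t)"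
      using add mult close by (simp add: ring_derivation_def)
  qed (use unique in blast)
qed

end
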